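(* $$\frac{\sin(6\pi/17)\sin(7\pi/17)}{\sin(3\pi/17)\sin(5\pi/17)}+\frac{\sin(4\pi/17)\sin(\pi/17)}{\sin(2\pi/17)\sin(8\pi/17)}-\frac{\sin(8\pi/17)\sin(2\pi/17)}{\sin(4\pi/17)\sin(\pi/17)}-\frac{\sin(5\pi/17)\sin(3\pi/17)}{\sin(6\pi/17)\sin(7\pi/17)}=-1.$$ *)

theory Defs
  imports Complex_Main
begin

end

theory Submission
  imports Defs
begin

text \<open>
  Put \<open>A = sin (6\<pi>/17) sin (7\<pi>/17)\<close>, \<open>B = sin (3\<pi>/17) sin (5\<pi>/17)\<close>,
  \<open>C = sin (4\<pi>/17) sin (\<pi>/17)\<close>, \<open>D = sin (2\<pi>/17) sin (8\<pi>/17)\<close> and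
  \<open>e\<^sub>k = cos (2k\<pi>/17)\<close>. In terms of the Gaussian periods of length four,
  set \<open>X = (e\<^sub>1 + e\<^sub>4) - (e\<^sub>2 + e\<^sub>8)\<close> and \<open>U = (e\<^sub>3 + e\<^sub>5) - (e\<^sub>6 + e\<^sub>7)\<close>. Then
  \<open>8AB = U + X\<close>, \<open>8CD = U - X\<close>, \<open>8(A\<^sup>2 - B\<^sup>2) = X + 2U\<close> and \<open>8(C\<^sup>2 - D\<^sup>2) = U - 2X\<close>, so after
  clearing denominators the claim becomes \<open>2(U\<^sup>2 - X\<^sup>2) = UX\<close>, which follows from the
  multiplication table of the periods.
\<close>

definition cos17 :: "int \<Rightarrow> real" where
  "cos17 k = cos (2 * of_int k * pi / 17)"

lemma cos17_uminus: "cos17 (- k) = cos17 k"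
  by (simp add: cos17_def)

lemma cos17_reflect: "cos17 (17 - k) = cos17 k"
proof -
  have "2 * of_int (17 - k) * pi / 17 = 2 * pi - 2 * of_int k * pi / 17"
    by (simp add: field_simps)
  then have "cos17 (17 - k) = cos (2 * pi - 2 * of_int k * pi / 17)"
    by (simp only: cos17_def)
  then show ?thesis
    by (simp add: cos17_def cos_diff)
qed

lemma cos17_0: "cos17 0 = 1"
  by (simp add: cos17_def)

lemma cos17_mult: "cos17 j * cos17 k = (cos17 (j - k) + cos17 (j + k)) / 2"
  by (simp add: cos17_def cos_times_cos diff_divide_distrib add_divide_distrib algebra_simps)

lemma cos17_reduce:
  "cos17 9 = cos17 8" "cos17 10 = cos17 7" "cos17 11 = cos17 6" "cos17 12 = cos17 5"
  "cos17 13 = cos17 4" "cos17 14 = cos17 3" "cos17 15 = cos17 2" "cos17 16 = cos17 1"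
  using cos17_reflect[of 8] cos17_reflect[of 7] cos17_reflect[of 6] cos17_reflect[of 5]
    cos17_reflect[of 4] cos17_reflect[of 3] cos17_reflect[of 2] cos17_reflect[of 1]
  by simp_all

text \<open>As rewrite rules these linearize products of two values with indices 1 to 8 into
  combinations of 1 and \<open>cos17 1\<close>, ..., \<open>cos17 8\<close>.\<close>

lemmas cos17_table =
  cos17_mult cos17_reduce cos17_0 cos17_uminus[of 1] cos17_uminus[of "numeral n" for n, simplified]

lemma sin17_mult_even:
  fixes j k :: int
  shows "sin (of_int (j + k) * pi / 17) * sin (of_int (j - k) * pi / 17) = (cos17 k - cos17 j) / 2"
  by (simp add: sin_times_sin cos17_def flip: diff_divide_distrib add_divide_distrib)
     (simp add: algebra_simps)

text \<open>For numerators of different parity: m -> 17 - m keeps the sine and flips the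
  parity.\<close>

lemma sin17_mult_odd:
  fixes j k :: int
  shows "sin (of_int (j + k) * pi / 17) * sin (of_int (17 - (j - k)) * pi / 17)
    = (cos17 k - cos17 j) / 2"
proof -
  have "of_int (17 - (j - k)) * pi / 17 = pi - of_int (j - k) * pi / 17"
    by (simp add: field_simps)
  then have "sin (of_int (17 - (j - k)) * pi / 17) = sin (of_int (j - k) * pi / 17)"
    by (simp only: sin_pi_minus)
  then show ?thesis
    using sin17_mult_even[of j k] by simp
qed

lemma sin17_products:
  "sin (6 * pi / 17) * sin (7 * pi / 17) = (cos17 2 - cos17 8) / 2"
  "sin (3 * pi / 17) * sin (5 * pi / 17) = (cos17 1 - cos17 4) / 2"
  "sin (4 * pi / 17) * sin (pi / 17) = (cos17 6 - cos17 7) / 2"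
  "sin (2 * pi / 17) * sin (8 * pi / 17) = (cos17 3 - cos17 5) / 2"
  \<comment> \<open>Half-sums and half-differences of the numerators (6,10), (5,3), (8,2), (4,16),
    where 10 and 16 reflect 7 and 1.\<close>
  using sin17_mult_odd[of 8 "-2"] sin17_mult_even[of 4 1] sin17_mult_even[of 5 3]
    sin17_mult_odd[of 10 "-6"]
  by (simp_all add: cos17_reduce cos17_uminus mult.commute)

text \<open>Both sides linearize to (e1 + e2 + e4 + e8) - (e3 + e5 + e6 + e7), with ek for
  \<open>cos17 k\<close>: half the difference of the two periods of length eight. On the left the
  constant 2 in each square cancels.\<close>

lemma period_relation:
  defines "X \<equiv> cos17 1 + cos17 4 - cos17 2 - cos17 8"
    and "U \<equiv> cos17 3 + cos17 5 - cos17 6 - cos17 7"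
  shows "2 * (U * U - X * X) = U * X"
  unfolding X_def U_def
  by (simp add: ring_distribs cos17_table) (simp add: field_simps)

theorem theorem4p3:
  shows "(sin (6 * pi / 17) * sin (7 * pi / 17)) / (sin (3 * pi / 17) * sin (5 * pi / 17))
       + (sin (4 * pi / 17) * sin (pi / 17)) / (sin (2 * pi / 17) * sin (8 * pi / 17))
       - (sin (8 * pi / 17) * sin (2 * pi / 17)) / (sin (4 * pi / 17) * sin (pi / 17))
       - (sin (5 * pi / 17) * sin (3 * pi / 17)) / (sin (6 * pi / 17) * sin (7 * pi / 17))
       = -1"
proof -
  define A where "A = sin (6 * pi / 17) * sin (7 * pi / 17)"
  define B where "B = sin (3 * pi / 17) * sin (5 * pi / 17)"
  define C where "C = sin (4 * pi / 17) * sin (pi / 17)"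
  define D where "D = sin (2 * pi / 17) * sin (8 * pi / 17)"
  define X where "X = cos17 1 + cos17 4 - cos17 2 - cos17 8"
  define U where "U = cos17 3 + cos17 5 - cos17 6 - cos17 7"
  have "A > 0" "B > 0" "C > 0" "D > 0"
    unfolding A_def B_def C_def D_def by (intro mult_pos_pos sin_gt_zero; simp)+
  then have nz: "A \<noteq> 0" "B \<noteq> 0" "C \<noteq> 0" "D \<noteq> 0"
    by simp_all
  have AB: "A * B = (U + X) / 8"
    unfolding A_def B_def sin17_products X_def U_def
    by (simp add: ring_distribs cos17_table) (simp add: field_simps)
  have CD: "C * D = (U - X) / 8"
    unfolding C_def D_def sin17_products X_def U_def
    by (simp add: ring_distribs cos17_table) (simp add: field_simps)
  have AABB: "A * A - B * B = (X + 2 * U) / 8"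
    unfolding A_def B_def sin17_products X_def U_def
    by (simp add: ring_distribs cos17_table) (simp add: field_simps)
  have CCDD: "C * C - D * D = (U - 2 * X) / 8"
    unfolding C_def D_def sin17_products X_def U_def
    by (simp add: ring_distribs cos17_table) (simp add: field_simps)
  \<comment> \<open>Since A/B - B/A = (A*A - B*B)/(A*B), and likewise for C and D, this is the claim
    with -1 moved to the left, multiplied by A*B*C*D.\<close>
  have "(A * A - B * B) * (C * D) + (C * C - D * D) * (A * B) + (A * B) * (C * D)
      = (2 * (2 * (U * U - X * X) - U * X)) / 64"
    unfolding AB CD AABB CCDD by (simp add: algebra_simps) (simp add: field_simps)
  also have "\<dots> = 0"
    using period_relation by (simp add: X_def U_def)
  finally have "A / B + C / D - D / C - B / A = - 1"
    using nz by (simp add: divide_simps) (simp add: algebra_simps)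
  then show ?thesis
    by (simp add: A_def B_def C_def D_def mult.commute)
qed

end
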